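(* Let $\mathcal{A}_1,\mathcal{A}_2,\mathcal{B}_1,\mathcal{B}_2$ be self-adjoint extensions of $A$ and let $P_i,Q_i$ be the orthogonal projections in $\mathfrak{H}\times\mathfrak{H}$ with $$\operatorname{tr}(\operatorname{dom}\mathcal{A}_i)=\operatorname{ran}P_i,\qquad \operatorname{tr}(\operatorname{dom}\mathcal{B}_i)=\operatorname{ran}Q_i,\qquad i=1,2.$$ Define, in $\mathcal{H}^2$, $$\mathcal{N}_i=\begin{pmatrix}0&-\mathcal{B}_i\\ \mathcal{A}_i&0\end{pmatrix},\qquad \operatorname{dom}(\mathcal{N}_i)=\operatorname{dom}(\mathcal{A}_i)\times\operatorname{dom}(\mathcal{B}_i),\qquad i=1,2.$$ Let $\zeta\notin\operatorname{Spec}(\mathcal{N}_1)\cup\operatorname{Spec}(\mathcal{N}_2)$ and denote $R_i(\zeta):=(\mathcal{N}_i-\zeta)^{-1}$, $i=1,2$. Then $\bar\zeta\notin\operatorname{Spec}(\mathcal{N}_1)\cup\operatorname{Spec}(\mathcal{N}_2)$ and one has $$R_1(\zeta)-R_2(\zeta)=\tau\big(\mathrm{T}R_1(\bar\zeta)\big)^*\mathcal{J}\,\mathrm{T}R_2(\zeta)$$ and $$R_1(\zeta)-R_2(\zeta)=\tau\big(\mathrm{T}R_1(\bar\zeta)\big)^*\Big((P_1JP_2)\oplus(-Q_1JQ_2)\Big)\mathrm{T}R_2(\zeta).$$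
   Context: $\mathcal{H},\mathfrak{H}$ are separable complex Hilbert spaces. $A$ is a closed, densely defined, symmetric linear operator in $\mathcal{H}$ with $\dim\ker(A^*+i)=\dim\ker(A^*-i)<\infty$. $\mathcal{H}_+:=\operatorname{dom}(A^* )$ is equipped with the graph scalar product of $A^*$. The trace operator $\operatorname{tr}=(\Gamma_0,\Gamma_1)^\top:\mathcal{H}_+\to\mathfrak{H}\times\mathfrak{H}$ is bounded, linear and surjective and satisfies, for all $u,v\in\operatorname{dom}(A^* )$, $$\langle A^*u,v\rangle_{\mathcal{H}}-\langle u,A^*v\rangle_{\mathcal{H}}=\langle\Gamma_1u,\Gamma_0v\rangle_{\mathfrak{H}}-\langle\Gamma_0u,\Gamma_1v\rangle_{\mathfrak{H}}.$$ Put $\mathcal{H}^2=\mathcal{H}\times\mathcal{H}$, $\mathcal{H}_+^2=\mathcal{H}_+\times\mathcal{H}_+$, $\mathfrak{H}^4=(\mathfrak{H}\times\mathfrak{H})\times(\mathfrak{H}\times\mathfrak{H})$. Define $$\mathrm{T}=\operatorname{tr}\oplus\operatorname{tr}:\mathcal{H}_+^2\to\mathfrak{H}^4,\quad \mathrm{T}(u_1,u_2)^\top=(\Gamma_0u_1,\Gamma_1u_1,\Gamma_0u_2,\Gamma_1u_2)^\top,$$ $$\tau=\begin{pmatrix}0&I_{\mathcal{H}}\\ I_{\mathcal{H}}&0\end{pmatrix}\ \text{on }\mathcal{H}^2,\qquad J=\begin{pmatrix}0&I_{\mathfrak{H}}\\ -I_{\mathfrak{H}}&0\end{pmatrix}\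 \text{on }\mathfrak{H}\times\mathfrak{H},\qquad \mathcal{J}=J\oplus(-J)\ \text{on }\mathfrak{H}^4.$$ For bounded operators $X,Y$ on $\mathfrak{H}\times\mathfrak{H}$, $X\oplus Y$ is the block diagonal operator on $\mathfrak{H}^4$. The operator $\mathrm{T}R_i(\zeta)$ is a bounded operator from $\mathcal{H}^2$ to $\mathfrak{H}^4$ and $(\cdot)^*$ denotes its Hilbert space adjoint $\mathfrak{H}^4\to\mathcal{H}^2$. *)

theory Defs
  imports "HOL-Analysis.Analysis"
begin

section \<open>Complex Hilbert spaces\<close>

text \<open>A complex inner product space is built on top of the library class \<open>real_inner\<close>: the real
  structure is the one obtained by restriction of scalars, and the real inner product is the real
  part of the complex one. Hence norm, topology and the product instance are those of the library.
  The complex inner product is linear in its first argument.\<close>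

class complex_vector = real_vector +
  fixes scaleC :: "complex \<Rightarrow> 'a \<Rightarrow> 'a" (infixr "*\<^sub>C" 75)
  assumes scaleC_add_right: "c *\<^sub>C (x + y) = c *\<^sub>C x + c *\<^sub>C y"
    and scaleC_add_left: "(c + d) *\<^sub>C x = c *\<^sub>C x + d *\<^sub>C x"
    and scaleC_scaleC: "c *\<^sub>C d *\<^sub>C x = (c * d) *\<^sub>C x"
    and scaleR_scaleC: "r *\<^sub>R x = complex_of_real r *\<^sub>C x"

lemma scaleC_one: "1 *\<^sub>C x = (x :: 'a :: complex_vector)"
  using scaleR_scaleC[of 1 x] by simp

global_interpretation complex_vector: vector_space "scaleC :: complex \<Rightarrow> 'a \<Rightarrow> 'a :: complex_vector"
  defines csubspace = complex_vector.subspace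
    and cspan = complex_vector.span
    and cdim = complex_vector.dim
  by unfold_locales (simp_all add: scaleC_add_right scaleC_add_left scaleC_scaleC scaleC_one)

class complex_inner = complex_vector + real_inner +
  fixes cinner :: "'a \<Rightarrow> 'a \<Rightarrow> complex"
  assumes cinner_commute: "cinner x y = cnj (cinner y x)"
    and cinner_add_left: "cinner (x + y) z = cinner x z + cinner y z"
    and cinner_scaleC_left: "cinner (c *\<^sub>C x) y = c * cinner x y"
    and inner_eq_Re_cinner: "inner x y = Re (cinner x y)"

class chilbert_space = complex_inner + complete_space

instantiation complex :: chilbert_space
begin

definition "scaleC_complex (c :: complex) (x :: complex) = c * x"

definition "cinner_complex (x :: complex) (y :: complex) = x * cnj y"

instance
  by standard
    (simp_all add: scaleC_complex_def cinner_complex_def algebra_simps scaleR_conv_of_real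
      inner_complex_def)

end

instantiation prod :: (complex_vector, complex_vector) complex_vector
begin

definition "scaleC_prod c (p :: 'a \<times> 'b) = (c *\<^sub>C fst p, c *\<^sub>C snd p)"

instance
  by standard
    (simp_all add: scaleC_prod_def scaleC_add_right scaleC_add_left scaleC_scaleC scaleR_scaleC
      prod_eq_iff)

end

instantiation prod :: (complex_inner, complex_inner) complex_inner
begin

definition "cinner_prod (p :: 'a \<times> 'b) q = cinner (fst p) (fst q) + cinner (snd p) (snd q)"

instance
proof
  fix x y z :: "'a \<times> 'b" and c :: complex
  show "cinner x y = cnj (cinner y x)"
    unfolding cinner_prod_def complex_cnj_add
    by (metis cinner_commute)
  show "cinner (x + y) z = cinner x z + cinner y z"
    by (simp add: cinner_prod_def cinner_add_left)
  show "cinner (c *\<^sub>C x) y = c * cinner x y"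
    by (simp add: cinner_prod_def scaleC_prod_def cinner_scaleC_left distrib_left)
  show "inner x y = Re (cinner x y)"
    by (simp add: cinner_prod_def inner_prod_def inner_eq_Re_cinner)
qed

end

instance prod :: (chilbert_space, chilbert_space) chilbert_space ..


section \<open>Bounded operators\<close>

definition clinear_on :: "'a :: complex_vector set \<Rightarrow> ('a \<Rightarrow> 'b :: complex_vector) \<Rightarrow> bool" where
  "clinear_on D f \<longleftrightarrow>
     (\<forall>u\<in>D. \<forall>v\<in>D. f (u + v) = f u + f v) \<and> (\<forall>c. \<forall>u\<in>D. f (c *\<^sub>C u) = c *\<^sub>C f u)"

definition bounded_clinear :: "('a :: complex_inner \<Rightarrow> 'b :: complex_inner) \<Rightarrow> bool" where
  "bounded_clinear f \<longleftrightarrow> clinear_on UNIV f \<and> (\<exists>K. \<forall>x. norm (f x) \<le> K * norm x)"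

text \<open>Complex counterpart of the library constant \<open>adjoint\<close>; meaningful for bounded operators
  between Hilbert spaces, where it exists and is unique.\<close>

definition cadjoint :: "('a :: chilbert_space \<Rightarrow> 'b :: chilbert_space) \<Rightarrow> 'b \<Rightarrow> 'a" where
  "cadjoint F = (SOME G. \<forall>x y. cinner (F x) y = cinner x (G y))"

definition orthogonal_projection :: "('a :: chilbert_space \<Rightarrow> 'a) \<Rightarrow> bool" where
  "orthogonal_projection P \<longleftrightarrow>
     bounded_clinear P \<and> P \<circ> P = P \<and> (\<forall>x y. cinner (P x) y = cinner x (P y))"


section \<open>Unbounded operators\<close>

text \<open>An operator is identified with its graph: equality of operators includes equality of
  domains, and \<open>S \<subseteq> T\<close> says that \<open>T\<close> is an extension of \<open>S\<close>.\<close>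

type_synonym ('a, 'b) op = "('a \<times> 'b) set"

definition linear_operator :: "('a :: complex_vector, 'b :: complex_vector) op \<Rightarrow> bool" where
  "linear_operator T \<longleftrightarrow> csubspace T \<and> single_valued T"

abbreviation dom_op :: "('a, 'b) op \<Rightarrow> 'a set" where
  "dom_op T \<equiv> Domain T"

definition app :: "('a, 'b) op \<Rightarrow> 'a \<Rightarrow> 'b" (infixr "\<cdot>" 76) where
  "T \<cdot> u = (THE w. (u, w) \<in> T)"

definition densely_defined :: "('a :: chilbert_space, 'b :: chilbert_space) op \<Rightarrow> bool" where
  "densely_defined T \<longleftrightarrow> closure (dom_op T) = UNIV"

abbreviation closed_operator :: "('a :: chilbert_space, 'b :: chilbert_space) op \<Rightarrow> bool" where
  "closed_operator T \<equiv> closed T"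

definition symmetric_operator :: "('a :: chilbert_space, 'a) op \<Rightarrow> bool" where
  "symmetric_operator T \<longleftrightarrow>
     (\<forall>u\<in>dom_op T. \<forall>v\<in>dom_op T. cinner (T \<cdot> u) v = cinner u (T \<cdot> v))"

text \<open>The adjoint; it is single-valued if \<open>T\<close> is densely defined.\<close>

definition adjoint_op :: "('a :: chilbert_space, 'b :: chilbert_space) op \<Rightarrow> ('b, 'a) op" where
  "adjoint_op T = {(v, w). \<forall>u\<in>dom_op T. cinner (T \<cdot> u) v = cinner u w}"

definition self_adjoint :: "('a :: chilbert_space, 'a) op \<Rightarrow> bool" where
  "self_adjoint T \<longleftrightarrow> linear_operator T \<and> densely_defined T \<and> adjoint_op T = T"

definition self_adjoint_extension ::
    "('a :: chilbert_space, 'a) op \<Rightarrow> ('a, 'a) op \<Rightarrow> bool" where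
  "self_adjoint_extension A T \<longleftrightarrow> A \<subseteq> T \<and> self_adjoint T"

definition ker_shift :: "('a :: complex_vector, 'a) op \<Rightarrow> complex \<Rightarrow> 'a set" where
  "ker_shift T z = {u \<in> dom_op T. T \<cdot> u + z *\<^sub>C u = 0}"

text \<open>The finiteness condition is needed because \<open>cdim\<close> is \<open>0\<close> on infinite-dimensional spaces.\<close>

definition equal_finite_deficiency_indices :: "('a :: chilbert_space, 'a) op \<Rightarrow> bool" where
  "equal_finite_deficiency_indices A \<longleftrightarrow>
     (\<exists>B. finite B \<and> ker_shift (adjoint_op A) \<i> = cspan B) \<and>
     (\<exists>B. finite B \<and> ker_shift (adjoint_op A) (- \<i>) = cspan B) \<and>
     cdim (ker_shift (adjoint_op A) \<i>) = cdim (ker_shift (adjoint_op A) (- \<i>))"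

definition resolvent :: "('a :: chilbert_space, 'a) op \<Rightarrow> complex \<Rightarrow> 'a \<Rightarrow> 'a" where
  "resolvent T z = the_inv_into (dom_op T) (\<lambda>u. T \<cdot> u - z *\<^sub>C u)"

definition resolvent_set :: "('a :: chilbert_space, 'a) op \<Rightarrow> complex set" where
  "resolvent_set T =
     {z. bij_betw (\<lambda>u. T \<cdot> u - z *\<^sub>C u) (dom_op T) UNIV \<and> bounded_clinear (resolvent T z)}"

definition Spec :: "('a :: chilbert_space, 'a) op \<Rightarrow> complex set" where
  "Spec T = - resolvent_set T"


section \<open>Boundary triples\<close>

definition graph_cinner ::
    "('a :: chilbert_space, 'b :: chilbert_space) op \<Rightarrow> 'a \<Rightarrow> 'a \<Rightarrow> complex" where
  "graph_cinner T u v = cinner u v + cinner (T \<cdot> u) (T \<cdot> v)"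

definition graph_norm :: "('a :: chilbert_space, 'b :: chilbert_space) op \<Rightarrow> 'a \<Rightarrow> real" where
  "graph_norm T u = sqrt (Re (graph_cinner T u u))"

definition tr :: "('a \<Rightarrow> 'b) \<Rightarrow> ('a \<Rightarrow> 'b) \<Rightarrow> 'a \<Rightarrow> 'b \<times> 'b" where
  "tr \<Gamma>\<^sub>0 \<Gamma>\<^sub>1 u = (\<Gamma>\<^sub>0 u, \<Gamma>\<^sub>1 u)"

text \<open>The maps \<open>\<Gamma>\<^sub>0\<close>, \<open>\<Gamma>\<^sub>1\<close> are total functions, but only their values on the domain of the adjoint
  of \<open>A\<close> are constrained.\<close>

definition trace_operator ::
    "('a :: chilbert_space, 'a) op \<Rightarrow> ('a \<Rightarrow> 'b :: chilbert_space) \<Rightarrow> ('a \<Rightarrow> 'b) \<Rightarrow> bool" where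
  "trace_operator A \<Gamma>\<^sub>0 \<Gamma>\<^sub>1 \<longleftrightarrow>
     clinear_on (dom_op (adjoint_op A)) (tr \<Gamma>\<^sub>0 \<Gamma>\<^sub>1) \<and>
     (\<exists>K. \<forall>u\<in>dom_op (adjoint_op A). norm (tr \<Gamma>\<^sub>0 \<Gamma>\<^sub>1 u) \<le> K * graph_norm (adjoint_op A) u) \<and>
     tr \<Gamma>\<^sub>0 \<Gamma>\<^sub>1 ` dom_op (adjoint_op A) = UNIV \<and>
     (\<forall>u\<in>dom_op (adjoint_op A). \<forall>v\<in>dom_op (adjoint_op A).
        cinner (adjoint_op A \<cdot> u) v - cinner u (adjoint_op A \<cdot> v) =
        cinner (\<Gamma>\<^sub>1 u) (\<Gamma>\<^sub>0 v) - cinner (\<Gamma>\<^sub>0 u) (\<Gamma>\<^sub>1 v))"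


section \<open>Block operators\<close>

definition block_diag :: "('a \<Rightarrow> 'c) \<Rightarrow> ('b \<Rightarrow> 'd) \<Rightarrow> 'a \<times> 'b \<Rightarrow> 'c \<times> 'd" (infixr "\<oplus>" 65) where
  "(X \<oplus> Y) = (\<lambda>(p, q). (X p, Y q))"

definition tr2 :: "('a \<Rightarrow> 'b) \<Rightarrow> ('a \<Rightarrow> 'b) \<Rightarrow> 'a \<times> 'a \<Rightarrow> ('b \<times> 'b) \<times> ('b \<times> 'b)" where
  "tr2 \<Gamma>\<^sub>0 \<Gamma>\<^sub>1 = tr \<Gamma>\<^sub>0 \<Gamma>\<^sub>1 \<oplus> tr \<Gamma>\<^sub>0 \<Gamma>\<^sub>1"

definition tau :: "'a \<times> 'a \<Rightarrow> 'a \<times> 'a" where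
  "tau = (\<lambda>(u, v). (v, u))"

definition J :: "'b \<times> 'b \<Rightarrow> 'b \<times> ('b :: ab_group_add)" where
  "J = (\<lambda>(x, y). (y, - x))"

definition JJ :: "('b \<times> 'b) \<times> ('b \<times> 'b) \<Rightarrow> ('b \<times> 'b) \<times> ('b \<times> ('b :: ab_group_add))" where
  "JJ = J \<oplus> (- J)"

definition block_op :: "('a :: chilbert_space, 'a) op \<Rightarrow> ('a, 'a) op \<Rightarrow> ('a \<times> 'a, 'a \<times> 'a) op" where
  "block_op A B = {((u, v), (- (B \<cdot> v), A \<cdot> u)) | u v. u \<in> dom_op A \<and> v \<in> dom_op B}"

end

theory Submission
  imports Defs
begin

text \<open>Write \<open>M\<close> for the maximal block operator \<open>block_op A\<^sup>* A\<^sup>*\<close>, of which \<open>N\<^sub>1\<close> and \<open>N\<^sub>2\<close> are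
  restrictions. Everything rests on two facts about the exchange \<open>\<tau>\<close> of the components.

  Since \<open>\<tau> N\<^sub>i\<close> is the self-adjoint operator \<open>A\<^sub>i \<oplus> (- B\<^sub>i)\<close>, the adjoint of \<open>N\<^sub>i\<close> is \<open>\<tau> N\<^sub>i \<tau>\<close>
  (\<open>block_op_tau_symmetric\<close>). Hence the resolvent set of \<open>N\<^sub>i\<close> is invariant under conjugation
  (\<open>cnj_notin_Spec_block_op\<close>) and \<open>R\<^sub>i(\<zeta>)\<^sup>* = \<tau> R\<^sub>i(cnj \<zeta>) \<tau>\<close>.

  On the larger operator \<open>M\<close> this symmetry fails, and the defect is the boundary form
  \<open>\<langle>\<J> T u, T w\<rangle>\<close> (\<open>green_identity_block_op\<close>). Taking \<open>w = R\<^sub>1(cnj \<zeta>) g\<close> in it, with \<open>u\<close> arbitrary in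
  the domain of \<open>M\<close>, and using the first fact to move \<open>w\<close> to the other side gives
  \<open>(T R\<^sub>1(cnj \<zeta>))\<^sup>* \<J> T u = \<tau> (R\<^sub>1(\<zeta>) (M - \<zeta>) u - u)\<close>
  (\<open>cinner_trace_resolvent\<close>). As \<open>T\<close> is onto, this formula describes the adjoint completely, and in
  particular shows that it exists. For \<open>u = R\<^sub>2(\<zeta>) f\<close> one has \<open>(M - \<zeta>) u = f\<close>, so that the
  right-hand side becomes \<open>\<tau> (R\<^sub>1(\<zeta>) f - R\<^sub>2(\<zeta>) f)\<close>: this is the first formula, as \<open>\<tau>\<close> is
  an involution.

  The second formula has the same pairings as the first, because \<open>P\<^sub>2 \<oplus> Q\<^sub>2\<close> fixes \<open>T R\<^sub>2(\<zeta>) f\<close> and the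
  self-adjoint \<open>P\<^sub>1 \<oplus> Q\<^sub>1\<close>, moved to the other factor, fixes \<open>T R\<^sub>1(cnj \<zeta>) g\<close>.\<close>


section \<open>The complex inner product\<close>

lemma cinner_add_right: "cinner x (y + z) = cinner x y + cinner x (z :: 'a :: complex_inner)"
  by (metis cinner_commute cinner_add_left complex_cnj_add)

lemma cinner_scaleC_right: "cinner x (c *\<^sub>C y) = cnj c * cinner x (y :: 'a :: complex_inner)"
  by (metis cinner_commute cinner_scaleC_left complex_cnj_mult)

lemma scaleC_minus_one: "(- 1) *\<^sub>C x = - (x :: 'a :: complex_vector)"
  using scaleR_scaleC[of "-1" x] by simp

lemma cinner_minus_left: "cinner (- x) y = - cinner x (y :: 'a :: complex_inner)"
  by (metis cinner_scaleC_left scaleC_minus_one mult_minus1)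

lemma cinner_minus_right: "cinner x (- y) = - cinner x (y :: 'a :: complex_inner)"
  by (metis cinner_commute cinner_minus_left complex_cnj_minus)

lemma cinner_diff_left: "cinner (x - y) z = cinner x z - cinner y (z :: 'a :: complex_inner)"
  using cinner_add_left[of x "- y" z] by (simp add: cinner_minus_left)

lemma cinner_diff_right: "cinner x (y - z) = cinner x y - cinner x (z :: 'a :: complex_inner)"
  using cinner_add_right[of x y "- z"] by (simp add: cinner_minus_right)

lemmas cinner_sesquilinear =
  cinner_add_left cinner_add_right cinner_minus_left cinner_minus_right
  cinner_diff_left cinner_diff_right cinner_scaleC_left cinner_scaleC_right

lemma cinner_zero_left [simp]: "cinner 0 (y :: 'a :: complex_inner) = 0"
  using cinner_diff_left[of 0 0 y] by simp

lemma cinner_zero_right [simp]: "cinner (x :: 'a :: complex_inner) 0 = 0"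
  using cinner_diff_right[of x 0 0] by simp

lemma cinner_left_eqI:
  fixes x y :: "'a :: complex_inner"
  assumes "\<And>z. cinner x z = cinner y z"
  shows "x = y"
proof -
  have "inner (x - y) (x - y) = 0"
    using assms by (simp add: inner_eq_Re_cinner cinner_diff_left)
  then show ?thesis by simp
qed

lemma cinner_right_eqI:
  fixes x y :: "'a :: complex_inner"
  assumes "\<And>z. cinner z x = cinner z y"
  shows "x = y"
  by (rule cinner_left_eqI) (metis assms cinner_commute)

lemma norm_scaleC: "norm (c *\<^sub>C x) = cmod c * norm (x :: 'a :: complex_inner)"
proof -
  have "cinner (c *\<^sub>C x) (c *\<^sub>C x) = (c * cnj c) * cinner x x"
    by (simp add: cinner_scaleC_left cinner_scaleC_right)
  then have "inner (c *\<^sub>C x) (c *\<^sub>C x) = (cmod c)\<^sup>2 * inner x x"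
    by (simp only: inner_eq_Re_cinner complex_norm_square[symmetric] times_complex.sel Re_complex_of_real
        Im_complex_of_real mult_zero_left diff_zero)
  then show ?thesis
    by (simp add: norm_eq_sqrt_inner real_sqrt_mult)
qed

text \<open>Rotating \<open>x\<close> by a unit scalar turns the modulus of the complex inner product into a real inner
  product, to which the real Cauchy-Schwarz inequality applies.\<close>

lemma complex_cauchy_schwarz: "cmod (cinner x y) \<le> norm x * norm (y :: 'a :: complex_inner)"
proof -
  define c where "c = cnj (sgn (cinner x y))"
  have "cinner (c *\<^sub>C x) y = complex_of_real (cmod (cinner x y))"
    by (cases "cinner x y = 0")
      (simp_all add: c_def cinner_scaleC_left sgn_eq mult.commute[of "cnj _"]
        complex_norm_square[symmetric] power2_eq_square)
  then have "cmod (cinner x y) = inner (c *\<^sub>C x) y"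
    by (simp add: inner_eq_Re_cinner)
  also have "\<dots> \<le> norm (c *\<^sub>C x) * norm y"
    by (rule norm_cauchy_schwarz)
  also have "\<dots> \<le> norm x * norm y"
    by (intro mult_right_mono) (simp_all add: norm_scaleC c_def norm_sgn)
  finally show ?thesis .
qed

lemma tau_tau [simp]: "tau (tau x) = x"
  by (simp add: tau_def split: prod.split)

lemma tau_diff: "tau (x - y) = tau x - tau (y :: 'a :: complex_inner \<times> 'a)"
  by (simp add: tau_def split: prod.split)

lemma norm_tau [simp]: "norm (tau x) = norm (x :: 'a :: complex_inner \<times> 'a)"
  by (simp add: tau_def norm_prod_def add.commute split: prod.split)


section \<open>The Riesz representation theorem\<close>

text \<open>The representing vector is the minimizer of the energy \<open>\<parallel>x\<parallel>\<^sup>2 / 2 - L x\<close>. By the parallelogram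
  law twice the energy of the midpoint of \<open>x\<close> and \<open>y\<close> lies \<open>\<parallel>x - y\<parallel>\<^sup>2 / 4\<close> below the sum of their
  energies, so that minimizing sequences are Cauchy; the variation of the energy at its minimizer
  vanishes, which is the assertion.\<close>

lemma real_riesz_representation:
  fixes L :: "'a :: {real_inner, complete_space} \<Rightarrow> real"
  assumes "bounded_linear L"
  obtains v where "\<And>x. L x = inner x v"
proof -
  interpret L: bounded_linear L by fact
  define q where "q x = (inner x x) / 2 - L x" for x
  obtain K where K: "\<And>x. norm (L x) \<le> norm x * K" using L.bounded by blast
  have low: "- (K\<^sup>2 / 2) \<le> q x" for x
  proof -
    have "L x \<le> norm x * K" using K[of x] by auto
    moreover have "0 \<le> (norm x - K)\<^sup>2" by simp
    ultimately show ?thesis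
      unfolding q_def power2_norm_eq_inner[symmetric] by (simp add: power2_eq_square algebra_simps)
  qed
  define m where "m = Inf (range q)"
  have bdd: "bdd_below (range q)" using low by (auto intro!: bdd_belowI[of _ "- (K\<^sup>2 / 2)"])
  have m_le: "m \<le> q x" for x unfolding m_def by (rule cInf_lower[OF _ bdd]) simp
  have "\<exists>x. q x < m + 1 / real (Suc n)" for n
    using cInf_lessD[of "range q" "m + 1 / real (Suc n)"] unfolding m_def by auto
  then obtain X where X: "\<And>n. q (X n) < m + 1 / real (Suc n)" by metis
  have mid: "q x + q y - 2 * q ((1/2) *\<^sub>R (x + y)) = (norm (x - y))\<^sup>2 / 4" for x y
    by (simp add: q_def L.scaleR L.add power2_norm_eq_inner algebra_simps inner_commute)
  \<comment> \<open>No energy is below \<open>m\<close>, that of the midpoint included, so a quarter of the squared distance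
    is at most the sum of the excesses of the two energies over \<open>m\<close>.\<close>
  have dist: "(norm (X i - X j))\<^sup>2 \<le> 8 / real (Suc N)" if "i \<ge> N" "j \<ge> N" for i j N
  proof -
    have "1 / real (Suc i) \<le> 1 / real (Suc N)" "1 / real (Suc j) \<le> 1 / real (Suc N)"
      using that by (auto simp: frac_le)
    then have "(norm (X i - X j))\<^sup>2 / 4 \<le> 2 * (1 / real (Suc N))"
      using mid[of "X i" "X j"] X[of i] X[of j] m_le[of "(1/2) *\<^sub>R (X i + X j)"] by linarith
    then show ?thesis by simp
  qed
  have "Cauchy X"
  proof (rule metric_CauchyI)
    fix e :: real assume "e > 0"
    then obtain N where N: "8 / e\<^sup>2 < real N" using reals_Archimedean2 by blast
    then have "8 / e\<^sup>2 < real (Suc N)" by simp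
    then have "8 / real (Suc N) < e\<^sup>2" using \<open>e > 0\<close> by (simp add: field_simps del: of_nat_Suc)
    then have "\<forall>i\<ge>N. \<forall>j\<ge>N. dist (X i) (X j) < e"
      using dist[of N] \<open>e > 0\<close> unfolding dist_norm
      by (meson le_less_trans less_le_not_le power2_less_imp_less)
    then show "\<exists>N. \<forall>i\<ge>N. \<forall>j\<ge>N. dist (X i) (X j) < e" by blast
  qed
  then obtain v where v: "X \<longlonglongrightarrow> v" using Cauchy_convergent convergent_def by blast
  have "(\<lambda>n. q (X n)) \<longlonglongrightarrow> q v"
    unfolding q_def by (intro tendsto_intros v L.tendsto) simp
  moreover have "(\<lambda>n. m + 1 / real (Suc n)) \<longlonglongrightarrow> m + 0"
    by (intro tendsto_intros LIMSEQ_inverse_real_of_nat[unfolded inverse_eq_divide])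
  ultimately have "q v \<le> m"
    using LIMSEQ_le[of "\<lambda>n. q (X n)" "q v" "\<lambda>n. m + 1 / real (Suc n)" m] X
    by (auto intro: less_imp_le)
  have "L x = inner x v" for x
  proof -
    define d where "d = inner x v - L x"
    have *: "0 \<le> t * d + t\<^sup>2 * inner x x / 2" for t
    proof -
      have "q v \<le> q (v + t *\<^sub>R x)" using \<open>q v \<le> m\<close> m_le order_trans by blast
      then show ?thesis
        by (simp add: q_def d_def L.add L.scaleR inner_commute power2_eq_square algebra_simps)
    qed
    have "d = 0"
    proof (cases "x = 0")
      case True
      then show ?thesis by (simp add: d_def L.zero)
    next
      case False
      then have "inner x x > 0" by simp
      \<comment> \<open>The quadratic \<open>t d + t\<^sup>2 \<parallel>x\<parallel>\<^sup>2 / 2\<close> is smallest at this \<open>t\<close>, with value \<open>- d\<^sup>2 / (2 \<parallel>x\<parallel>\<^sup>2)\<close>.\<close>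
      with *[of "- d / inner x x"] have "d\<^sup>2 \<le> 0"
        by (simp add: power2_eq_square field_simps)
      then show ?thesis by simp
    qed
    then show ?thesis by (simp add: d_def)
  qed
  then show thesis using that by blast
qed

text \<open>A complex linear functional is determined by its real part, because its imaginary part at \<open>x\<close>
  is its real part at \<open>- \<i> x\<close>.\<close>

lemma riesz_representation:
  fixes \<phi> :: "'a :: chilbert_space \<Rightarrow> complex"
  assumes "bounded_clinear \<phi>"
  obtains v where "\<And>x. \<phi> x = cinner x v"
proof -
  obtain K where lin: "clinear_on UNIV \<phi>" and K: "\<And>x. norm (\<phi> x) \<le> K * norm x"
    using assms unfolding bounded_clinear_def by blast
  have add: "\<phi> (x + y) = \<phi> x + \<phi> y" and sc: "\<phi> (c *\<^sub>C x) = c * \<phi> x" for x y c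
    using lin by (auto simp: clinear_on_def scaleC_complex_def)
  have "bounded_linear (\<lambda>x. Re (\<phi> x))"
  proof (rule bounded_linear_intro)
    fix x y and r :: real
    show "Re (\<phi> (x + y)) = Re (\<phi> x) + Re (\<phi> y)" by (simp add: add)
    show "Re (\<phi> (r *\<^sub>R x)) = r *\<^sub>R Re (\<phi> x)" by (simp add: scaleR_scaleC sc)
    show "norm (Re (\<phi> x)) \<le> norm x * K"
      using K[of x] abs_Re_le_cmod[of "\<phi> x"] by (simp add: mult.commute)
  qed
  then obtain v where v: "\<And>x. Re (\<phi> x) = inner x v"
    using real_riesz_representation by blast
  have "\<phi> x = cinner x v" for x
  proof (rule complex_eqI)
    show "Re (\<phi> x) = Re (cinner x v)" using v by (simp add: inner_eq_Re_cinner)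
    show "Im (\<phi> x) = Im (cinner x v)"
      using v[of "(- \<i>) *\<^sub>C x"]
      by (simp add: inner_eq_Re_cinner sc cinner_scaleC_left del: complex_vector.scale_minus_left)
  qed
  then show thesis using that by blast
qed


section \<open>Adjoints and self-adjoint extensions\<close>

lemma app_eqI:
  assumes "single_valued T" "(u, w) \<in> T"
  shows "T \<cdot> u = w"
  unfolding app_def using assms by (auto simp: single_valued_def)

lemma app_in_graph:
  assumes "single_valued T" "u \<in> dom_op T"
  shows "(u, T \<cdot> u) \<in> T"
  using assms app_eqI by fastforce

lemma single_valued_adjoint_op:
  assumes "densely_defined T"
  shows "single_valued (adjoint_op T)"
proof (rule single_valuedI)
  fix v w w' assume "(v, w) \<in> adjoint_op T" "(v, w') \<in> adjoint_op T"
  then have orth: "inner u (w - w') = 0" if "u \<in> dom_op T" for u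
    using that by (auto simp: adjoint_op_def inner_eq_Re_cinner cinner_diff_right)
  have "closed {u. inner u (w - w') = 0}"
    by (intro closed_Collect_eq continuous_intros)
  with orth have "closure (dom_op T) \<subseteq> {u. inner u (w - w') = 0}"
    by (intro closure_minimal) auto
  with assms have "inner (w - w') (w - w') = 0"
    unfolding densely_defined_def by blast
  then show "w = w'" by simp
qed

lemma self_adjoint_single_valued: "self_adjoint T \<Longrightarrow> single_valued T"
  by (simp add: self_adjoint_def linear_operator_def)

lemma self_adjoint_symmetric:
  assumes "self_adjoint T" "u \<in> dom_op T" "v \<in> dom_op T"
  shows "cinner (T \<cdot> u) v = cinner u (T \<cdot> v)"
proof -
  have "(v, T \<cdot> v) \<in> adjoint_op T"
    using assms app_in_graph[OF self_adjoint_single_valued] by (metis self_adjoint_def)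
  then show ?thesis using assms by (auto simp: adjoint_op_def)
qed

text \<open>This is the inclusion \<open>T\<^sup>* \<subseteq> T\<close>, in the form in which vectors are recognized as elements of the
  domain of \<open>T\<close>.\<close>

lemma self_adjoint_graphI:
  assumes "self_adjoint T" "\<And>u. u \<in> dom_op T \<Longrightarrow> cinner (T \<cdot> u) v = cinner u w"
  shows "v \<in> dom_op T" "T \<cdot> v = w"
proof -
  have "(v, w) \<in> adjoint_op T" using assms(2) by (simp add: adjoint_op_def)
  then have "(v, w) \<in> T" using assms(1) by (simp add: self_adjoint_def)
  then show "v \<in> dom_op T" "T \<cdot> v = w"
    using app_eqI[OF self_adjoint_single_valued[OF assms(1)]] by blast+
qed

text \<open>Taking adjoints reverses inclusions, so that \<open>A \<subseteq> T = T\<^sup>*\<close> gives \<open>T \<subseteq> A\<^sup>*\<close>.\<close>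

lemma self_adjoint_extension_restricts_adjoint:
  assumes "densely_defined A" "self_adjoint_extension A T" "u \<in> dom_op T"
  shows "u \<in> dom_op (adjoint_op A)" "adjoint_op A \<cdot> u = T \<cdot> u"
proof -
  have sub: "A \<subseteq> T" and sa: "self_adjoint T"
    using assms(2) by (auto simp: self_adjoint_extension_def)
  have svA: "single_valued A"
    using sub self_adjoint_single_valued[OF sa] by (rule single_valued_subset)
  have "(u, T \<cdot> u) \<in> adjoint_op A"
  proof -
    have "cinner (A \<cdot> x) u = cinner x (T \<cdot> u)" if "x \<in> dom_op A" for x
    proof -
      have "(x, A \<cdot> x) \<in> T" using sub app_in_graph[OF svA that] by blast
      then have "x \<in> dom_op T" "T \<cdot> x = A \<cdot> x"
        using app_eqI[OF self_adjoint_single_valued[OF sa]] by blast+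
      then show ?thesis using self_adjoint_symmetric[OF sa _ assms(3), of x] by simp
    qed
    then show ?thesis by (simp add: adjoint_op_def)
  qed
  then show "u \<in> dom_op (adjoint_op A)" "adjoint_op A \<cdot> u = T \<cdot> u"
    using app_eqI[OF single_valued_adjoint_op[OF assms(1)]] by blast+
qed

lemma self_adjoint_zero_in_dom:
  assumes "self_adjoint T"
  shows "0 \<in> dom_op T" "T \<cdot> 0 = 0"
  using self_adjoint_graphI[OF assms, of 0 0] by auto

lemma self_adjoint_linear:
  assumes "self_adjoint T" "u \<in> dom_op T" "v \<in> dom_op T"
  shows "u + v \<in> dom_op T" "T \<cdot> (u + v) = T \<cdot> u + T \<cdot> v"
    and "c *\<^sub>C u \<in> dom_op T" "T \<cdot> (c *\<^sub>C u) = c *\<^sub>C (T \<cdot> u)"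
  using self_adjoint_graphI[OF assms(1), of "u + v" "T \<cdot> u + T \<cdot> v"]
    self_adjoint_graphI[OF assms(1), of "c *\<^sub>C u" "c *\<^sub>C (T \<cdot> u)"]
    self_adjoint_symmetric[OF assms(1)] assms(2,3)
  by (auto simp: cinner_sesquilinear)

text \<open>\<open>cadjoint\<close> is specified by choice, so its value at a single \<open>y\<close> can be identified only once an
  adjoint is known to exist at every argument.\<close>

lemma cadjoint_eqI:
  fixes F :: "'a :: chilbert_space \<Rightarrow> 'b :: chilbert_space"
  assumes ex: "\<And>y. \<exists>g. \<forall>x. cinner (F x) y = cinner x g"
    and g: "\<And>x. cinner (F x) y = cinner x g"
  shows "cadjoint F y = g"
proof -
  have "\<exists>G. \<forall>x y. cinner (F x) y = cinner x (G y)"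
    using ex by metis
  then have "\<forall>x y. cinner (F x) y = cinner x (cadjoint F y)"
    unfolding cadjoint_def by (rule someI_ex)
  then show ?thesis using g by (metis cinner_right_eqI)
qed

lemma orthogonal_projection_fixes_range:
  assumes "orthogonal_projection P" "p \<in> range P"
  shows "P p = p"
  using assms by (auto simp: orthogonal_projection_def fun_eq_iff)

lemma resolvent_in_dom:
  assumes "z \<notin> Spec N"
  shows "resolvent N z f \<in> dom_op N"
  using assms unfolding Spec_def resolvent_set_def resolvent_def bij_betw_def
  by (auto intro!: the_inv_into_into)

lemma resolvent_right_inverse:
  assumes "z \<notin> Spec N"
  shows "N \<cdot> resolvent N z f - z *\<^sub>C resolvent N z f = f"
  using assms f_the_inv_into_f[of "\<lambda>u. N \<cdot> u - z *\<^sub>C u" "dom_op N" f]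
  unfolding Spec_def resolvent_set_def resolvent_def bij_betw_def by auto

lemma resolvent_bounded_clinear:
  assumes "z \<notin> Spec N"
  shows "bounded_clinear (resolvent N z)"
  using assms unfolding Spec_def resolvent_set_def by auto


section \<open>The spectrum of an off-diagonal block operator\<close>

lemma dom_block_op: "dom_op (block_op A B) = dom_op A \<times> dom_op B"
  unfolding block_op_def by (auto simp: Domain_iff)

lemma app_block_op:
  assumes "u \<in> dom_op A" "v \<in> dom_op B"
  shows "block_op A B \<cdot> (u, v) = (- (B \<cdot> v), A \<cdot> u)"
  using assms by (intro app_eqI) (auto simp: block_op_def single_valued_def)

text \<open>The symmetric half of \<open>N\<^sup>* = \<tau> N \<tau>\<close> for \<open>N = block_op A B\<close>: following \<open>N\<close> by the exchange of the
  two components gives the self-adjoint operator \<open>A \<oplus> (- B)\<close>.\<close>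

lemma block_op_tau_symmetric:
  assumes "self_adjoint A" "self_adjoint B"
    and "u \<in> dom_op (block_op A B)" "w \<in> dom_op (block_op A B)"
  shows "cinner (block_op A B \<cdot> u - z *\<^sub>C u) (tau w)
    = cinner (tau u) (block_op A B \<cdot> w - cnj z *\<^sub>C w)"
proof -
  obtain u1 u2 w1 w2 where uw: "u = (u1, u2)" "w = (w1, w2)" by fastforce
  then have d: "u1 \<in> dom_op A" "u2 \<in> dom_op B" "w1 \<in> dom_op A" "w2 \<in> dom_op B"
    using assms by (auto simp: dom_block_op)
  show ?thesis
    using self_adjoint_symmetric[OF assms(1) d(1,3)] self_adjoint_symmetric[OF assms(2) d(2,4)]
    by (simp add: uw app_block_op d tau_def cinner_prod_def scaleC_prod_def cinner_sesquilinear)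
qed

text \<open>The bounded operator \<open>(N - z)\<^sup>-\<^sup>1\<close> has a bounded adjoint, and conjugating that adjoint by \<open>\<tau>\<close>
  gives \<open>(N - cnj z)\<^sup>-\<^sup>1\<close>, by the previous lemma. Surjectivity of \<open>N - cnj z\<close> is where completeness
  enters, through the Riesz theorem; the domain of \<open>N\<close> is large enough because \<open>A\<close> and \<open>B\<close> are
  self-adjoint and not just symmetric.\<close>

lemma cnj_notin_Spec_block_op:
  fixes A B :: "('h :: chilbert_space, 'h) op"
  assumes A: "self_adjoint A" and B: "self_adjoint B" and z: "z \<notin> Spec (block_op A B)"
  shows "cnj z \<notin> Spec (block_op A B)"
proof -
  define N where "N = block_op A B"
  define R where "R = resolvent N z"
  define S where "S u = N \<cdot> u - cnj z *\<^sub>C u" for u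
  have Rd: "R f \<in> dom_op N" and Re: "N \<cdot> R f - z *\<^sub>C R f = f" for f
    using resolvent_in_dom resolvent_right_inverse z by (auto simp: R_def N_def)
  obtain K where Rlin: "clinear_on UNIV R" and K: "\<And>x. norm (R x) \<le> K * norm x"
    using resolvent_bounded_clinear[OF z] unfolding bounded_clinear_def R_def N_def by blast
  have sym: "cinner f (tau w) = cinner (tau (R f)) (S w)" if "w \<in> dom_op N" for f w
    using block_op_tau_symmetric[OF A B Rd[of f, unfolded N_def] that[unfolded N_def], of z] Re[of f]
    by (simp add: N_def S_def)

  have add: "u + v \<in> dom_op N" "S (u + v) = S u + S v"
    and sc: "c *\<^sub>C u \<in> dom_op N" "S (c *\<^sub>C u) = c *\<^sub>C S u"
    if "u \<in> dom_op N" "v \<in> dom_op N" for u v c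
  proof -
    obtain u1 u2 v1 v2 where uv: "u = (u1, u2)" "v = (v1, v2)" by fastforce
    then have d: "u1 \<in> dom_op A" "u2 \<in> dom_op B" "v1 \<in> dom_op A" "v2 \<in> dom_op B"
      using that by (auto simp: dom_block_op N_def)
    note cA = self_adjoint_linear[OF A d(1,3)] and cB = self_adjoint_linear[OF B d(2,4)]
    have cm: "c *\<^sub>C d *\<^sub>C x = d *\<^sub>C c *\<^sub>C x" for c d and x :: 'h
      by (simp add: scaleC_scaleC mult.commute)
    show "u + v \<in> dom_op N" "c *\<^sub>C u \<in> dom_op N"
      using cA cB by (auto simp: uv dom_block_op N_def scaleC_prod_def)
    show "S (u + v) = S u + S v"
      using cA cB d by (simp add: uv S_def N_def app_block_op scaleC_prod_def scaleC_add_right)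
    show "S (c *\<^sub>C u) = c *\<^sub>C S u"
      using cA cB d cm by (simp add: uv S_def N_def app_block_op scaleC_prod_def
          complex_vector.scale_right_diff_distrib)
  qed

  \<comment> \<open>The bound of the resolvent at \<open>z\<close> also serves at \<open>cnj z\<close>, an operator and its adjoint having
    the same norm.\<close>
  have low: "norm w \<le> K * norm (S w)" if w: "w \<in> dom_op N" for w
  proof (cases "w = 0")
    case True
    have "0 \<le> K * norm (S w)"
      using order_trans[OF norm_ge_zero K[of "S w"]] .
    with True show ?thesis by simp
  next
    case False
    have "norm w * norm w = inner (tau w) (tau w)"
      by (metis norm_tau power2_norm_eq_inner power2_eq_square)
    also have "\<dots> = inner (tau (R (tau w))) (S w)"
      by (simp add: inner_eq_Re_cinner sym[OF w])
    also have "\<dots> \<le> norm (R (tau w)) * norm (S w)"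
      by (metis norm_cauchy_schwarz norm_tau)
    also have "\<dots> \<le> (K * norm w) * norm (S w)"
      using K[of "tau w"] by (intro mult_right_mono) auto
    finally show ?thesis using False by (simp add: mult.assoc mult.left_commute)
  qed

  have inj: "inj_on S (dom_op N)"
  proof (rule inj_onI)
    fix u v assume uv: "u \<in> dom_op N" "v \<in> dom_op N" "S u = S v"
    have "- v \<in> dom_op N" "S (- v) = - S v"
      using sc[OF uv(2,2), of "- 1"] by (simp_all only: scaleC_minus_one)
    then have "u + - v \<in> dom_op N" "S (u + - v) = 0"
      using add[OF uv(1), of "- v"] uv(3) by simp_all
    then show "u = v" using low[of "u + - v"] by simp
  qed

  have surj: "\<exists>w\<in>dom_op N. S w = h" for h
  proof -
    have "bounded_clinear (\<lambda>f. cinner (R f) (tau h))"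
    proof -
      have "norm (cinner (R f) (tau h)) \<le> (K * norm h) * norm f" for f
        using order_trans[OF complex_cauchy_schwarz[of "R f" "tau h"] mult_right_mono[OF K[of f]]]
        by (simp add: mult_ac)
      then show ?thesis
        using Rlin unfolding bounded_clinear_def
        by (auto simp: clinear_on_def cinner_sesquilinear scaleC_complex_def)
    qed
    then obtain v where v: "\<And>f. cinner (R f) (tau h) = cinner f v"
      using riesz_representation by blast
    \<comment> \<open>The preimage of \<open>h\<close> is \<open>\<tau> v\<close>. Testing with \<open>(u\<^sub>1, 0)\<close> and with \<open>(0, u\<^sub>2)\<close> puts its components
      in the domains of \<open>A\<close> and \<open>B\<close>.\<close>
    obtain v1 v2 h1 h2 where vh: "v = (v1, v2)" "h = (h1, h2)" by fastforce
    have eq: "cinner u (tau h) = cinner (N \<cdot> u - z *\<^sub>C u) v" if "u \<in> dom_op N" for u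
    proof -
      have "R (N \<cdot> u - z *\<^sub>C u) = u"
        using that z the_inv_into_f_f[of "\<lambda>u. N \<cdot> u - z *\<^sub>C u" "dom_op N" u]
        unfolding R_def N_def Spec_def resolvent_set_def resolvent_def bij_betw_def by auto
      then show ?thesis using v by metis
    qed
    have eqA: "cinner (A \<cdot> u1) v2 = cinner u1 (h2 + cnj z *\<^sub>C v1)" if u1: "u1 \<in> dom_op A" for u1
      using eq[of "(u1, 0)"] u1 self_adjoint_zero_in_dom[OF B]
      by (simp add: N_def dom_block_op app_block_op vh tau_def cinner_prod_def scaleC_prod_def
          cinner_sesquilinear)
    have a: "v2 \<in> dom_op A" "A \<cdot> v2 = h2 + cnj z *\<^sub>C v1"
      using self_adjoint_graphI[OF A eqA] by auto
    have eqB: "cinner (B \<cdot> u2) v1 = cinner u2 (- h1 - cnj z *\<^sub>C v2)" if u2: "u2 \<in> dom_op B" for u2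
      using eq[of "(0, u2)"] u2 self_adjoint_zero_in_dom[OF A]
      by (simp add: N_def dom_block_op app_block_op vh tau_def cinner_prod_def scaleC_prod_def
          cinner_sesquilinear)
    have b: "v1 \<in> dom_op B" "B \<cdot> v1 = - h1 - cnj z *\<^sub>C v2"
      using self_adjoint_graphI[OF B eqB] by auto
    have "(v2, v1) \<in> dom_op N" "S (v2, v1) = h"
      using a b by (auto simp: N_def dom_block_op S_def app_block_op scaleC_prod_def vh)
    then show ?thesis by blast
  qed

  have bij: "bij_betw S (dom_op N) UNIV"
    using inj surj unfolding bij_betw_def by (metis UNIV_eq_I image_eqI)
  define Q where "Q = resolvent N (cnj z)"
  have Q_alt: "Q = the_inv_into (dom_op N) S"
    by (simp add: Q_def resolvent_def S_def[abs_def])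
  have Q: "Q h \<in> dom_op N" "S (Q h) = h" for h
    using bij the_inv_into_into[OF inj, of h] f_the_inv_into_f[OF inj, of h]
    by (auto simp: Q_alt bij_betw_def)
  have Q_eqI: "Q h = w" if "w \<in> dom_op N" "S w = h" for h w
    using the_inv_into_f_eq[OF inj that(2,1)] by (simp add: Q_alt)
  have "bounded_clinear Q"
    unfolding bounded_clinear_def clinear_on_def
  proof (intro conjI ballI allI exI)
    show "Q (u + v) = Q u + Q v" for u v using Q add Q_eqI by metis
    show "Q (c *\<^sub>C u) = c *\<^sub>C Q u" for c u using Q sc Q_eqI by metis
    show "norm (Q x) \<le> K * norm x" for x using low[of "Q x"] Q by metis
  qed
  with bij show ?thesis
    by (simp add: Spec_def resolvent_set_def Q_def N_def[symmetric] S_def[abs_def])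
qed


section \<open>The adjoint of the trace of the resolvent\<close>

text \<open>The Green identity of the boundary triple, written for the maximal block operator. The terms
  with \<open>z\<close> cancel because \<open>\<tau>\<close> is symmetric.\<close>

lemma green_identity_block_op:
  fixes \<Gamma>\<^sub>0 \<Gamma>\<^sub>1 :: "'h :: chilbert_space \<Rightarrow> 'k :: chilbert_space"
  assumes "trace_operator A \<Gamma>\<^sub>0 \<Gamma>\<^sub>1"
  defines "M \<equiv> block_op (adjoint_op A) (adjoint_op A)"
  assumes "u \<in> dom_op M" "w \<in> dom_op M"
  shows "cinner (JJ (tr2 \<Gamma>\<^sub>0 \<Gamma>\<^sub>1 u)) (tr2 \<Gamma>\<^sub>0 \<Gamma>\<^sub>1 w)
    = cinner (M \<cdot> u - z *\<^sub>C u) (tau w) - cinner (tau u) (M \<cdot> w - cnj z *\<^sub>C w)"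
proof -
  let ?D = "dom_op (adjoint_op A)"
  obtain u1 u2 w1 w2 where uw: "u = (u1, u2)" "w = (w1, w2)" by fastforce
  then have d: "u1 \<in> ?D" "u2 \<in> ?D" "w1 \<in> ?D" "w2 \<in> ?D"
    using assms by (auto simp: dom_block_op)
  have green: "cinner (adjoint_op A \<cdot> x) y - cinner x (adjoint_op A \<cdot> y) =
        cinner (\<Gamma>\<^sub>1 x) (\<Gamma>\<^sub>0 y) - cinner (\<Gamma>\<^sub>0 x) (\<Gamma>\<^sub>1 y)" if "x \<in> ?D" "y \<in> ?D" for x y
    using assms(1) that unfolding trace_operator_def by blast
  show ?thesis
    using green[OF d(1,3)] green[OF d(2,4)]
    by (simp add: uw M_def app_block_op d tau_def cinner_prod_def scaleC_prod_def
        cinner_sesquilinear JJ_def J_def tr2_def tr_def block_diag_def) algebra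
qed

lemma block_op_restricts_maximal:
  assumes "densely_defined A" "self_adjoint_extension A A\<^sub>1" "self_adjoint_extension A B\<^sub>1"
    and "u \<in> dom_op (block_op A\<^sub>1 B\<^sub>1)"
  shows "u \<in> dom_op (block_op (adjoint_op A) (adjoint_op A))"
    and "block_op (adjoint_op A) (adjoint_op A) \<cdot> u = block_op A\<^sub>1 B\<^sub>1 \<cdot> u"
proof -
  obtain u1 u2 where u: "u = (u1, u2)" by fastforce
  then have d: "u1 \<in> dom_op A\<^sub>1" "u2 \<in> dom_op B\<^sub>1" using assms by (auto simp: dom_block_op)
  note a = self_adjoint_extension_restricts_adjoint[OF assms(1,2) d(1)]
    and b = self_adjoint_extension_restricts_adjoint[OF assms(1,3) d(2)]
  show "u \<in> dom_op (block_op (adjoint_op A) (adjoint_op A))"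
    and "block_op (adjoint_op A) (adjoint_op A) \<cdot> u = block_op A\<^sub>1 B\<^sub>1 \<cdot> u"
    using a b d by (auto simp: u dom_block_op app_block_op)
qed

text \<open>The trace of the resolvent, paired with the boundary value of an arbitrary \<open>u\<close> in the maximal
  domain. The right-hand factor measures how far \<open>u\<close> is from satisfying the boundary conditions of
  \<open>N = block_op A\<^sub>1 B\<^sub>1\<close>: it vanishes on the domain of \<open>N\<close>.\<close>

lemma cinner_trace_resolvent:
  fixes \<Gamma>\<^sub>0 \<Gamma>\<^sub>1 :: "'h :: chilbert_space \<Rightarrow> 'k :: chilbert_space"
  assumes dd: "densely_defined A" and tr: "trace_operator A \<Gamma>\<^sub>0 \<Gamma>\<^sub>1"
    and ext: "self_adjoint_extension A A\<^sub>1" "self_adjoint_extension A B\<^sub>1"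
  defines "M \<equiv> block_op (adjoint_op A) (adjoint_op A)" and "N \<equiv> block_op A\<^sub>1 B\<^sub>1"
  assumes z: "z \<notin> Spec N" "cnj z \<notin> Spec N" and u: "u \<in> dom_op M"
  shows "cinner (tr2 \<Gamma>\<^sub>0 \<Gamma>\<^sub>1 (resolvent N (cnj z) g)) (JJ (tr2 \<Gamma>\<^sub>0 \<Gamma>\<^sub>1 u))
    = cinner g (tau (resolvent N z (M \<cdot> u - z *\<^sub>C u) - u))"
proof -
  have sa: "self_adjoint A\<^sub>1" "self_adjoint B\<^sub>1"
    using ext by (auto simp: self_adjoint_extension_def)
  define w where "w = resolvent N (cnj z) g"
  define h where "h = M \<cdot> u - z *\<^sub>C u"
  define v where "v = resolvent N z h"
  have w: "w \<in> dom_op N" "N \<cdot> w - cnj z *\<^sub>C w = g"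
    and v: "v \<in> dom_op N" "N \<cdot> v - z *\<^sub>C v = h"
    using resolvent_in_dom resolvent_right_inverse z by (auto simp: w_def v_def)
  have wM: "w \<in> dom_op M" "M \<cdot> w = N \<cdot> w"
    using block_op_restricts_maximal[OF dd ext] w(1) by (auto simp: M_def N_def)
  have "cinner (JJ (tr2 \<Gamma>\<^sub>0 \<Gamma>\<^sub>1 u)) (tr2 \<Gamma>\<^sub>0 \<Gamma>\<^sub>1 w) = cinner h (tau w) - cinner (tau u) g"
    using green_identity_block_op[OF tr u[unfolded M_def] wM(1)[unfolded M_def], of z] wM(2) w(2)
    by (simp add: h_def M_def)
  also have "cinner h (tau w) = cinner (tau v) g"
    using block_op_tau_symmetric[OF sa v(1)[unfolded N_def] w(1)[unfolded N_def], of z] v(2) w(2)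
    by (simp add: N_def)
  also have "cinner (tau v) g - cinner (tau u) g = cinner (tau (v - u)) g"
    by (simp add: tau_diff cinner_diff_left)
  finally show ?thesis
    by (metis cinner_commute h_def v_def w_def)
qed

text \<open>Since the trace is surjective, every boundary vector has the form \<open>\<J> T u\<close>, and the adjoint of
  the trace of the resolvent is obtained explicitly.\<close>

lemma trace_resolvent_adjoint_exists:
  fixes \<Gamma>\<^sub>0 \<Gamma>\<^sub>1 :: "'h :: chilbert_space \<Rightarrow> 'k :: chilbert_space"
  assumes "densely_defined A" and tr: "trace_operator A \<Gamma>\<^sub>0 \<Gamma>\<^sub>1"
    and "self_adjoint_extension A A\<^sub>1" "self_adjoint_extension A B\<^sub>1"
    and "z \<notin> Spec (block_op A\<^sub>1 B\<^sub>1)" "cnj z \<notin> Spec (block_op A\<^sub>1 B\<^sub>1)"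
  shows "\<exists>k. \<forall>g. cinner (tr2 \<Gamma>\<^sub>0 \<Gamma>\<^sub>1 (resolvent (block_op A\<^sub>1 B\<^sub>1) (cnj z) g)) y = cinner g k"
proof -
  let ?D = "dom_op (adjoint_op A)"
  obtain a b c d where y: "y = ((a, b), (c, d))" by (metis surj_pair)
  have surj: "tr \<Gamma>\<^sub>0 \<Gamma>\<^sub>1 ` ?D = UNIV"
    using tr unfolding trace_operator_def by blast
  obtain u1 where u1: "u1 \<in> ?D" "tr \<Gamma>\<^sub>0 \<Gamma>\<^sub>1 u1 = (- b, a)" using surj by (metis UNIV_I imageE)
  obtain u2 where u2: "u2 \<in> ?D" "tr \<Gamma>\<^sub>0 \<Gamma>\<^sub>1 u2 = (d, - c)" using surj by (metis UNIV_I imageE)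
  have "JJ (tr2 \<Gamma>\<^sub>0 \<Gamma>\<^sub>1 (u1, u2)) = y"
    using u1 u2 by (simp add: JJ_def J_def tr2_def block_diag_def y)
  moreover have "(u1, u2) \<in> dom_op (block_op (adjoint_op A) (adjoint_op A))"
    using u1 u2 by (simp add: dom_block_op)
  ultimately show ?thesis
    using cinner_trace_resolvent[OF assms] by metis
qed

theorem theorem2p3:
  fixes A :: "('h :: chilbert_space, 'h) op"
    and \<Gamma>\<^sub>0 \<Gamma>\<^sub>1 :: "'h \<Rightarrow> 'k :: chilbert_space"
    and A\<^sub>1 A\<^sub>2 B\<^sub>1 B\<^sub>2 :: "('h, 'h) op"
    and P\<^sub>1 P\<^sub>2 Q\<^sub>1 Q\<^sub>2 :: "'k \<times> 'k \<Rightarrow> 'k \<times> 'k"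
    and N\<^sub>1 N\<^sub>2 :: "('h \<times> 'h, 'h \<times> 'h) op"
    and \<zeta> :: complex
    and T :: "'h \<times> 'h \<Rightarrow> ('k \<times> 'k) \<times> ('k \<times> 'k)"
    and R\<^sub>1 R\<^sub>2 :: "complex \<Rightarrow> 'h \<times> 'h \<Rightarrow> 'h \<times> 'h"
  assumes "separable_space (euclidean :: 'h topology)"
    and "separable_space (euclidean :: 'k topology)"
    and "linear_operator A" "closed_operator A" "densely_defined A" "symmetric_operator A"
    and "equal_finite_deficiency_indices A"
    and "trace_operator A \<Gamma>\<^sub>0 \<Gamma>\<^sub>1"
    and "self_adjoint_extension A A\<^sub>1" "self_adjoint_extension A A\<^sub>2"
    and "self_adjoint_extension A B\<^sub>1" "self_adjoint_extension A B\<^sub>2"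
    and "orthogonal_projection P\<^sub>1" "orthogonal_projection P\<^sub>2"
    and "orthogonal_projection Q\<^sub>1" "orthogonal_projection Q\<^sub>2"
    and "tr \<Gamma>\<^sub>0 \<Gamma>\<^sub>1 ` dom_op A\<^sub>1 = range P\<^sub>1" "tr \<Gamma>\<^sub>0 \<Gamma>\<^sub>1 ` dom_op A\<^sub>2 = range P\<^sub>2"
    and "tr \<Gamma>\<^sub>0 \<Gamma>\<^sub>1 ` dom_op B\<^sub>1 = range Q\<^sub>1" "tr \<Gamma>\<^sub>0 \<Gamma>\<^sub>1 ` dom_op B\<^sub>2 = range Q\<^sub>2"
    and "N\<^sub>1 = block_op A\<^sub>1 B\<^sub>1" "N\<^sub>2 = block_op A\<^sub>2 B\<^sub>2"
    and "\<zeta> \<notin> Spec N\<^sub>1 \<union> Spec N\<^sub>2"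
    and "T = tr2 \<Gamma>\<^sub>0 \<Gamma>\<^sub>1" "R\<^sub>1 = resolvent N\<^sub>1" "R\<^sub>2 = resolvent N\<^sub>2"
  shows "cnj \<zeta> \<notin> Spec N\<^sub>1 \<union> Spec N\<^sub>2 \<and>
    R\<^sub>1 \<zeta> - R\<^sub>2 \<zeta> = tau \<circ> cadjoint (T \<circ> R\<^sub>1 (cnj \<zeta>)) \<circ> JJ \<circ> (T \<circ> R\<^sub>2 \<zeta>) \<and>
    R\<^sub>1 \<zeta> - R\<^sub>2 \<zeta> =
      tau \<circ> cadjoint (T \<circ> R\<^sub>1 (cnj \<zeta>)) \<circ>
        ((P\<^sub>1 \<circ> J \<circ> P\<^sub>2) \<oplus> (- (Q\<^sub>1 \<circ> J \<circ> Q\<^sub>2))) \<circ> (T \<circ> R\<^sub>2 \<zeta>)"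
proof -
  note dd = assms(5) and tr = assms(8) and extA = assms(9,10) and extB = assms(11,12)
  note N = assms(21,22) and TR = assms(24-26)
  define M where "M = block_op (adjoint_op A) (adjoint_op A)"
  define F where "F = T \<circ> R\<^sub>1 (cnj \<zeta>)"
  have sa: "self_adjoint A\<^sub>1" "self_adjoint A\<^sub>2" "self_adjoint B\<^sub>1" "self_adjoint B\<^sub>2"
    using extA extB by (auto simp: self_adjoint_extension_def)
  have z: "\<zeta> \<notin> Spec N\<^sub>1" "\<zeta> \<notin> Spec N\<^sub>2" using assms(23) by auto
  have cz: "cnj \<zeta> \<notin> Spec N\<^sub>1" "cnj \<zeta> \<notin> Spec N\<^sub>2"
    using cnj_notin_Spec_block_op sa z unfolding N by blast+
  have F_adj: "\<exists>k. \<forall>g. cinner (F g) y = cinner g k" for y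
    using trace_resolvent_adjoint_exists[OF dd tr extA(1) extB(1) z(1)[unfolded N] cz(1)[unfolded N]]
    by (simp add: F_def TR N)

  have R2: "R\<^sub>2 \<zeta> f \<in> dom_op N\<^sub>2" "N\<^sub>2 \<cdot> R\<^sub>2 \<zeta> f - \<zeta> *\<^sub>C R\<^sub>2 \<zeta> f = f" for f
    using resolvent_in_dom[OF z(2)] resolvent_right_inverse[OF z(2)] by (auto simp: TR)
  have pair: "cinner (F g) (JJ (T (R\<^sub>2 \<zeta> f))) = cinner g (tau (R\<^sub>1 \<zeta> f - R\<^sub>2 \<zeta> f))" for f g
  proof -
    have *: "R\<^sub>2 \<zeta> f \<in> dom_op M" "M \<cdot> R\<^sub>2 \<zeta> f - \<zeta> *\<^sub>C R\<^sub>2 \<zeta> f = f"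
      using block_op_restricts_maximal[OF dd extA(2) extB(2)] R2[of f] by (auto simp: M_def N)
    then show ?thesis
      using cinner_trace_resolvent[OF dd tr extA(1) extB(1) z(1)[unfolded N] cz(1)[unfolded N],
          of "R\<^sub>2 \<zeta> f" g]
      by (simp add: F_def TR N M_def)
  qed

  have fixed: "P (fst t) = fst t \<and> Q (snd t) = snd t"
    if "orthogonal_projection P" "orthogonal_projection Q"
      "tr \<Gamma>\<^sub>0 \<Gamma>\<^sub>1 ` dom_op C = range P" "tr \<Gamma>\<^sub>0 \<Gamma>\<^sub>1 ` dom_op D = range Q"
      "u \<in> dom_op (block_op C D)" "t = T u"
    for P Q C D u t
  proof -
    obtain u1 u2 where u: "u = (u1, u2)" by fastforce
    then have "u1 \<in> dom_op C" "u2 \<in> dom_op D"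
      using that(5) by (auto simp: dom_block_op)
    then have "tr \<Gamma>\<^sub>0 \<Gamma>\<^sub>1 u1 \<in> range P" "tr \<Gamma>\<^sub>0 \<Gamma>\<^sub>1 u2 \<in> range Q"
      using that(3,4) by blast+
    then show ?thesis
      using orthogonal_projection_fixes_range that(1,2,6)
      by (auto simp: u TR tr2_def block_diag_def)
  qed
  let ?PQ = "(P\<^sub>1 \<circ> J \<circ> P\<^sub>2) \<oplus> (- (Q\<^sub>1 \<circ> J \<circ> Q\<^sub>2))"
  have proj: "cinner (F g) (?PQ (T (R\<^sub>2 \<zeta> f))) = cinner (F g) (JJ (T (R\<^sub>2 \<zeta> f)))" for f g
  proof -
    have "R\<^sub>1 (cnj \<zeta>) g \<in> dom_op N\<^sub>1"
      using resolvent_in_dom[OF cz(1)] by (simp add: TR)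
    then have 1: "P\<^sub>1 (fst (F g)) = fst (F g)" "Q\<^sub>1 (snd (F g)) = snd (F g)"
      using fixed[OF assms(13,15,17,19), of "R\<^sub>1 (cnj \<zeta>) g" "F g"] by (auto simp: N F_def)
    have 2: "P\<^sub>2 (fst (T (R\<^sub>2 \<zeta> f))) = fst (T (R\<^sub>2 \<zeta> f))" "Q\<^sub>2 (snd (T (R\<^sub>2 \<zeta> f))) = snd (T (R\<^sub>2 \<zeta> f))"
      using fixed[OF assms(14,16,18,20), of "R\<^sub>2 \<zeta> f"] R2(1)[of f] by (auto simp: N)
    have sP: "cinner p (P\<^sub>1 q) = cinner (P\<^sub>1 p) q" and sQ: "cinner p (Q\<^sub>1 q) = cinner (Q\<^sub>1 p) q" for p q
      using assms(13,15) unfolding orthogonal_projection_def by metis+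
    show ?thesis
      using 1 2
      by (simp add: cinner_prod_def[of "F g"] block_diag_def JJ_def case_prod_beta sP sQ
          cinner_minus_right)
  qed
  have "cadjoint F (JJ (T (R\<^sub>2 \<zeta> f))) = tau (R\<^sub>1 \<zeta> f - R\<^sub>2 \<zeta> f)"
    and "cadjoint F (?PQ (T (R\<^sub>2 \<zeta> f))) = tau (R\<^sub>1 \<zeta> f - R\<^sub>2 \<zeta> f)" for f
    by (rule cadjoint_eqI[OF F_adj], simp add: pair proj)+
  then show ?thesis
    using cz by (simp add: fun_eq_iff F_def)
qed

end
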